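(* Let $n \geq 3$ and let a local $n$-quasigroup be defined by the equation $$x_{n+1} = F(x_1, \ldots, x_n) = \frac{f_1(x_1) + \ldots + f_n(x_n)}{x_1 + \ldots + x_n},$$ where $f_1, \ldots, f_n$ are functions of one variable each. This local $n$-quasigroup is irreducible if and only if for any two functions $f_i(x_i)$ and $f_j(x_j)$ with $i \neq j$, either $f_i$ and $f_j$ are not both linear homogeneous, or they are both linear homogeneous but $\frac{f_i(x_i)}{x_i} \neq \frac{f_j(x_j)}{x_j}$ (that is, $f_i(x_i) = c_i x_i$ and $f_j(x_j) = c_j x_j$ with constants $c_i \neq c_j$).
   Context: An $n$-quasigroup is a set $Q$ with an $n$-ary operation $A$ such that each equation $A(a_1, \ldots, a_{i-1}, x, a_{i+1}, \ldots, a_n) = b$ is uniquely solvable for $x$, $i = 1, \ldots, n$. Here we deal with local differentiable $n$-quasigroups given by $x_{n+1} = F(x_1, \ldots, x_n)$: $F$ is a real-valued $C^2$-function on an open box $D = I_1 \times \ldots \times I_n \subset \mathbb{R}^n$ (each $I_i$ an open interval), and the equation is locally solvable with respect to each variable, i.e. $F_i = \partial F/\partial x_i \neq 0$ at every point of $D$ for $i = 1, \ldots, n$. For $F$ of the form in the claim, each $f_i : I_i \to \mathbb{R}$ is of class $C^2$ and $x_1 + \ldots + x_n \neq 0$ on $D$. A local $n$-quasigroup ($n \geq 3$) is reducible if, after a suitable renumbering of the variables $x_1, \ldots, x_n$, its function has the form $$F(x_1, \ldots, x_n) = g(h(x_1, \ldots, x_k), x_{k+1}, \ldots, x_n) \quad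 \text{on } D$$ for some integer $k$ with $2 \leq k \leq n-1$ and some $C^2$-functions $h$ (of $k$ variables) and $g$ (of $n+1-k$ variables), i.e. the operation reduces to a $k$-ary and an $(n+1-k)$-ary operation. Otherwise it is irreducible. A function $f_i(x_i)$ is linear homogeneous if $f_i(x_i) = c_i x_i$ for some constant $c_i$.
   Formalization: The condition is required for every C² tuple f_1,…,f_n representing F, not only the given one; F fixes the f_i only up to constants of sum zero, and (1,1,x_3²) on (1,2)³ gives a reducible F although none of the f_i is linear homogeneous. *)

theory Defs
  imports "HOL-Analysis.Analysis" "HOL-Combinatorics.Permutations"
begin

text \<open>
  A point of $m$-dimensional real space is an extensional function
  \<open>{1..m} \<rightarrow>\<^sub>E UNIV\<close>, that is, a point of the library's topological space
  \<open>powertop_real {1..m}\<close>.  The dimension has to be a term, not a type, because the number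
  \<open>k\<close> of inner variables is existentially quantified in the definition of reducibility.
\<close>

definition partial_deriv :: "nat \<Rightarrow> ((nat \<Rightarrow> real) \<Rightarrow> real) \<Rightarrow> (nat \<Rightarrow> real) \<Rightarrow> real" where
  "partial_deriv i f x = deriv (\<lambda>t. f (x(i := t))) (x i)"

text \<open>
  \<open>Ck_on r m U f\<close>: all partial derivatives of \<open>f\<close> up to order \<open>r\<close> exist and are continuous
  on \<open>U\<close>.  It is only used for sets \<open>U\<close> open in \<open>powertop_real {1..m}\<close>.
\<close>

primrec Ck_on ::
  "nat \<Rightarrow> nat \<Rightarrow> (nat \<Rightarrow> real) set \<Rightarrow> ((nat \<Rightarrow> real) \<Rightarrow> real) \<Rightarrow> bool" where
  "Ck_on 0 m U f \<longleftrightarrow>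
     continuous_map (subtopology (powertop_real {1..m}) U) euclideanreal f"
| "Ck_on (Suc r) m U f \<longleftrightarrow>
     continuous_map (subtopology (powertop_real {1..m}) U) euclideanreal f \<and>
     (\<forall>i\<in>{1..m}. (\<forall>x\<in>U. (\<lambda>t. f (x(i := t))) differentiable (at (x i))) \<and>
                  Ck_on r m U (partial_deriv i f))"

definition C2_real :: "real set \<Rightarrow> (real \<Rightarrow> real) \<Rightarrow> bool" where
  "C2_real S \<phi> \<longleftrightarrow>
     (\<forall>t\<in>S. \<phi> differentiable (at t)) \<and>
     (\<forall>t\<in>S. deriv \<phi> differentiable (at t)) \<and>
     continuous_on S (deriv (deriv \<phi>))"

definition open_interval :: "real set \<Rightarrow> bool" where
  "open_interval S \<longleftrightarrow> open S \<and> is_interval S \<and> S \<noteq> {}"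

definition local_quasigroup ::
  "nat \<Rightarrow> (nat \<Rightarrow> real set) \<Rightarrow> ((nat \<Rightarrow> real) \<Rightarrow> real) \<Rightarrow> bool" where
  "local_quasigroup n I F \<longleftrightarrow>
     (\<forall>i\<in>{1..n}. open_interval (I i)) \<and>
     Ck_on 2 n (Pi\<^sub>E {1..n} I) F \<and>
     (\<forall>i\<in>{1..n}. \<forall>x\<in>Pi\<^sub>E {1..n} I. partial_deriv i F x \<noteq> 0)"

text \<open>
  The renumbering is the permutation \<open>\<sigma>\<close>: the inner function \<open>h\<close> is applied to
  $(x_{\sigma 1}, \ldots, x_{\sigma k})$, and the outer function \<open>g\<close> to
  $(h(\ldots), x_{\sigma(k+1)}, \ldots, x_{\sigma n})$.
  The domain of \<open>g\<close> is some open set \<open>V\<close> containing all the arguments that occur.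
\<close>

definition reducible ::
  "nat \<Rightarrow> (nat \<Rightarrow> real set) \<Rightarrow> ((nat \<Rightarrow> real) \<Rightarrow> real) \<Rightarrow> bool" where
  "reducible n I F \<longleftrightarrow>
     (\<exists>\<sigma> k h g V.
        \<sigma> permutes {1..n} \<and> 2 \<le> k \<and> k \<le> n - 1 \<and>
        Ck_on 2 k (\<Pi>\<^sub>E m\<in>{1..k}. I (\<sigma> m)) h \<and>
        openin (powertop_real {1..n + 1 - k}) V \<and>
        Ck_on 2 (n + 1 - k) V g \<and>
        (\<forall>x\<in>Pi\<^sub>E {1..n} I.
           let y = (\<lambda>m\<in>{1..n + 1 - k}.
                      if m = 1 then h (\<lambda>j\<in>{1..k}. x (\<sigma> j)) else x (\<sigma> (k + m - 1)))
           in y \<in> V \<and> F x = g y))"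

definition irreducible_quasigroup ::
  "nat \<Rightarrow> (nat \<Rightarrow> real set) \<Rightarrow> ((nat \<Rightarrow> real) \<Rightarrow> real) \<Rightarrow> bool" where
  "irreducible_quasigroup n I F \<longleftrightarrow> \<not> reducible n I F"

definition linear_homogeneous :: "real set \<Rightarrow> (real \<Rightarrow> real) \<Rightarrow> bool" where
  "linear_homogeneous S \<phi> \<longleftrightarrow> (\<exists>c. \<forall>t\<in>S. \<phi> t = c * t)"

text \<open>
  The numerator functions are determined by \<open>F\<close> only up to constants with sum zero, while
  linear homogeneity is not invariant under adding constants: $(2 + x_3^2)/(x_1 + x_2 + x_3)$ is
  reducible, and it is defined by $(1, 1, t^2)$ as well as by $(0, 0, t^2 + 2)$.  Hence a criterion
  for the irreducibility of \<open>F\<close> has to consider all \<open>f\<close> with \<open>defined_by n I F f\<close>.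
\<close>

definition defined_by ::
  "nat \<Rightarrow> (nat \<Rightarrow> real set) \<Rightarrow> ((nat \<Rightarrow> real) \<Rightarrow> real) \<Rightarrow> (nat \<Rightarrow> real \<Rightarrow> real) \<Rightarrow> bool" where
  "defined_by n I F f \<longleftrightarrow>
     (\<forall>i\<in>{1..n}. C2_real (I i) (f i)) \<and>
     (\<forall>x\<in>Pi\<^sub>E {1..n} I.
        (\<Sum>i=1..n. x i) \<noteq> 0 \<and> F x = (\<Sum>i=1..n. f i (x i)) / (\<Sum>i=1..n. x i))"

end

theory Submission
  imports Defs
begin

text \<open>
  Write \<open>S\<close> for the denominator and \<open>N\<close> for the numerator of \<open>F\<close>.  If \<open>i\<close>, \<open>j\<close> are inner variables
  of a reduction and \<open>l\<close> is an outer one, then the ratio \<open>F\<^sub>i / F\<^sub>j = h\<^sub>i / h\<^sub>j\<close> does not depend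
  on \<open>x\<^sub>l\<close>.  Differentiating \<open>(f\<^sub>i' S - N) h\<^sub>j = (f\<^sub>j' S - N) h\<^sub>i\<close> with respect to \<open>x\<^sub>l\<close> and using
  \<open>F\<^sub>l \<noteq> 0\<close> gives \<open>h\<^sub>i = h\<^sub>j\<close>, so \<open>f\<^sub>i'(x\<^sub>i) = f\<^sub>j'(x\<^sub>j)\<close> is a constant \<open>c\<close>.  The constant terms of
  \<open>f\<^sub>i\<close> and \<open>f\<^sub>j\<close> are then moved into \<open>f\<^sub>l\<close>.  Conversely, \<open>c x\<^sub>i\<close> and \<open>c x\<^sub>j\<close> enter \<open>F\<close> only through
  \<open>h = x\<^sub>i + x\<^sub>j\<close>.
\<close>

section \<open>Calculus of \<open>Ck_on\<close>\<close>

lemma DERIV_partial_deriv: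
  assumes "(\<lambda>t. f (x(i := t))) differentiable (at (x i))"
  shows "((\<lambda>t. f (x(i := t))) has_real_derivative partial_deriv i f x) (at (x i))"
  using assms by (simp add: partial_deriv_def DERIV_deriv_iff_real_differentiable)

text \<open>The slice is the preimage of \<open>U\<close> under \<open>x(i := t)\<close>, a
  continuous function of \<open>t\<close> because \<open>x\<close> is extensional. It allows partial
  derivatives at \<open>x\<close> to be compared for functions that agree only on
  \<open>U\<close>.\<close>

lemma open_coordinate_slice:
  assumes "openin (powertop_real {1..m}) U" "x \<in> U" "i \<in> {1..m}"
  shows "open {t. x(i := t) \<in> U}"
proof -
  have "x \<in> extensional {1..m}"
    using openin_subset[OF assms(1)] assms(2) by (auto simp: PiE_def)
  then have "continuous_map euclideanreal (powertop_real {1..m}) (\<lambda>t. x(i := t))"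
    using assms(3) by (auto simp: continuous_map_componentwise extensional_def fun_upd_def)
  from openin_continuous_map_preimage[OF this assms(1)] show ?thesis
    by simp
qed

lemma DERIV_partial_transform:
  assumes "openin (powertop_real {1..m}) U" "x \<in> U" "i \<in> {1..m}"
    and "\<And>y. y \<in> U \<Longrightarrow> f y = g y"
    and "((\<lambda>t. f (x(i := t))) has_real_derivative D) (at (x i))"
  shows "((\<lambda>t. g (x(i := t))) has_real_derivative D) (at (x i))"
  by (rule has_field_derivative_transform_within_open[OF assms(5) open_coordinate_slice[OF assms(1-3)]])
     (use assms in auto)

text \<open>Near a point of the open set \<open>U\<close> a coordinate line stays in
  \<open>U\<close>, so agreement on \<open>U\<close> is inherited by the partial derivatives. The
  induction therefore has to generalise over both functions.\<close>

lemma Ck_on_cong: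
  assumes U: "openin (powertop_real {1..m}) U"
    and "\<And>x. x \<in> U \<Longrightarrow> f x = g x" and "Ck_on r m U f"
  shows "Ck_on r m U g"
  using assms(2,3)
proof (induction r arbitrary: f g)
  case 0
  then show ?case
    by (auto intro: continuous_map_eq)
next
  case (Suc r)
  have D: "((\<lambda>t. g (x(i := t))) has_real_derivative partial_deriv i f x) (at (x i))"
    if "i \<in> {1..m}" "x \<in> U" for i x
    by (rule DERIV_partial_transform[OF U that(2,1) Suc.prems(1)])
       (use Suc.prems(2) that in \<open>auto intro: DERIV_partial_deriv simp del: fun_upd_apply\<close>)
  have "Ck_on r m U (partial_deriv i g)" if "i \<in> {1..m}" for i
  proof (rule Suc.IH[of "partial_deriv i f"])
    show "partial_deriv i f x = partial_deriv i g x" if "x \<in> U" for x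
      using DERIV_imp_deriv[OF D[OF \<open>i \<in> {1..m}\<close> that]] by (simp add: partial_deriv_def)
  qed (use Suc.prems that in auto)
  moreover have "continuous_map (subtopology (powertop_real {1..m}) U) euclideanreal g"
    using Suc.prems by (auto intro: continuous_map_eq)
  ultimately show ?case
    using D real_differentiable_def by fastforce
qed

text \<open>Lets an explicit formula \<open>f'\<close> stand in for \<open>partial_deriv\<close>,
  with which it need agree only on \<open>U\<close>. All closure rules below supply such a formula
  and then argue by induction on the order.\<close>

lemma Ck_on_SucI:
  assumes U: "openin (powertop_real {1..m}) U"
    and cont: "continuous_map (subtopology (powertop_real {1..m}) U) euclideanreal f"
    and D: "\<And>i x. i \<in> {1..m} \<Longrightarrow> x \<in> U \<Longrightarrow>
              ((\<lambda>t. f (x(i := t))) has_real_derivative f' i x) (at (x i))"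
    and C: "\<And>i. i \<in> {1..m} \<Longrightarrow> Ck_on r m U (f' i)"
  shows "Ck_on (Suc r) m U f"
proof -
  have "Ck_on r m U (partial_deriv i f)" if "i \<in> {1..m}" for i
  proof (rule Ck_on_cong[OF U _ C[OF that]])
    show "f' i x = partial_deriv i f x" if "x \<in> U" for x
      using DERIV_imp_deriv[OF D[OF \<open>i \<in> {1..m}\<close> that]] by (simp add: partial_deriv_def)
  qed
  then show ?thesis
    using cont D real_differentiable_def by fastforce
qed

lemma Ck_on_continuous:
  "Ck_on r m U f \<Longrightarrow> continuous_map (subtopology (powertop_real {1..m}) U) euclideanreal f"
  by (cases r) auto

lemma Ck_on_SucD: "Ck_on (Suc r) m U f \<Longrightarrow> Ck_on r m U f"
  by (induction r arbitrary: f) auto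

lemma Ck_on_DERIV:
  assumes "Ck_on (Suc r) m U f" "i \<in> {1..m}" "x \<in> U"
  shows "((\<lambda>t. f (x(i := t))) has_real_derivative partial_deriv i f x) (at (x i))"
  using assms by (intro DERIV_partial_deriv) auto

lemma Ck_on_const:
  assumes U: "openin (powertop_real {1..m}) U"
  shows "Ck_on r m U (\<lambda>x. c)"
proof (induction r arbitrary: c)
  case (Suc r)
  show ?case
    by (rule Ck_on_SucI[OF U, where f' = "\<lambda>i x. 0"]) (auto simp: Suc)
qed auto

lemma Ck_on_add:
  assumes U: "openin (powertop_real {1..m}) U"
    and "Ck_on r m U f" "Ck_on r m U g"
  shows "Ck_on r m U (\<lambda>x. f x + g x)"
  using assms(2,3)
proof (induction r arbitrary: f g)
  case 0
  then show ?case
    by (auto intro: continuous_map_add)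
next
  case (Suc r)
  show ?case
  proof (rule Ck_on_SucI[OF U, where f' = "\<lambda>i x. partial_deriv i f x + partial_deriv i g x"])
    show "continuous_map (subtopology (powertop_real {1..m}) U) euclideanreal (\<lambda>x. f x + g x)"
      using Suc.prems by (auto intro: continuous_map_add)
    show "((\<lambda>t. f (x(i := t)) + g (x(i := t))) has_real_derivative
        partial_deriv i f x + partial_deriv i g x) (at (x i))" if "i \<in> {1..m}" "x \<in> U" for i x
      using Ck_on_DERIV[OF Suc.prems(1) that] Ck_on_DERIV[OF Suc.prems(2) that]
      by (rule DERIV_add)
    show "Ck_on r m U (\<lambda>x. partial_deriv i f x + partial_deriv i g x)" if "i \<in> {1..m}" for i
      using Suc.prems that by (intro Suc.IH) auto
  qed
qed

lemma Ck_on_mult: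
  assumes U: "openin (powertop_real {1..m}) U"
    and "Ck_on r m U f" "Ck_on r m U g"
  shows "Ck_on r m U (\<lambda>x. f x * g x)"
  using assms(2,3)
proof (induction r arbitrary: f g)
  case 0
  then show ?case
    by (auto intro: continuous_map_real_mult)
next
  case (Suc r)
  show ?case
  proof (rule Ck_on_SucI[OF U,
        where f' = "\<lambda>i x. partial_deriv i f x * g x + partial_deriv i g x * f x"])
    show "continuous_map (subtopology (powertop_real {1..m}) U) euclideanreal (\<lambda>x. f x * g x)"
      using Suc.prems by (auto intro: continuous_map_real_mult)
    show "((\<lambda>t. f (x(i := t)) * g (x(i := t))) has_real_derivative
        partial_deriv i f x * g x + partial_deriv i g x * f x) (at (x i))"
      if "i \<in> {1..m}" "x \<in> U" for i x
      using DERIV_mult[OF Ck_on_DERIV[OF Suc.prems(1) that] Ck_on_DERIV[OF Suc.prems(2) that]]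
      by (simp add: fun_upd_def)
    \<comment> \<open>The product rule keeps one factor undifferentiated, so \<open>f\<close> and
      \<open>g\<close> are also needed at the lower order \<open>r\<close>.\<close>
    show "Ck_on r m U (\<lambda>x. partial_deriv i f x * g x + partial_deriv i g x * f x)"
      if "i \<in> {1..m}" for i
      using Suc.prems[THEN Ck_on_SucD] Suc.prems that
      by (intro Ck_on_add[OF U] Suc.IH) auto
  qed
qed

text \<open>The derivative is a product of a constant, a partial derivative of \<open>f\<close> and
  two copies of \<open>inverse f\<close>. The induction hypothesis for the same \<open>f\<close>
  covers the latter, and closure under products does the rest.\<close>

lemma Ck_on_inverse:
  assumes U: "openin (powertop_real {1..m}) U"
    and "Ck_on r m U f" and nz: "\<And>x. x \<in> U \<Longrightarrow> f x \<noteq> 0"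
  shows "Ck_on r m U (\<lambda>x. inverse (f x))"
  using assms(2)
proof (induction r)
  case 0
  then show ?case
    using nz by (auto intro: continuous_map_real_inverse)
next
  case (Suc r)
  show ?case
  proof (rule Ck_on_SucI[OF U,
        where f' = "\<lambda>i x. (- 1) * (partial_deriv i f x * (inverse (f x) * inverse (f x)))"])
    show "continuous_map (subtopology (powertop_real {1..m}) U) euclideanreal (\<lambda>x. inverse (f x))"
      using Suc.prems nz by (auto intro: continuous_map_real_inverse)
    show "((\<lambda>t. inverse (f (x(i := t)))) has_real_derivative
        (- 1) * (partial_deriv i f x * (inverse (f x) * inverse (f x)))) (at (x i))"
      if "i \<in> {1..m}" "x \<in> U" for i x
      using DERIV_inverse_fun[OF Ck_on_DERIV[OF Suc.prems that]] nz[OF that(2)]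
      by (simp add: fun_upd_def mult_ac)
    show "Ck_on r m U (\<lambda>x. (- 1) * (partial_deriv i f x * (inverse (f x) * inverse (f x))))"
      if "i \<in> {1..m}" for i
      using Suc.IH[OF Ck_on_SucD[OF Suc.prems]] Suc.prems that
      by (intro Ck_on_mult[OF U] Ck_on_const[OF U]) auto
  qed
qed

lemma Ck_on_sum:
  assumes U: "openin (powertop_real {1..m}) U"
    and "\<And>i. i \<in> A \<Longrightarrow> Ck_on r m U (f i)"
  shows "Ck_on r m U (\<lambda>x. \<Sum>i\<in>A. f i x)"
  using assms(2)
  by (induction A rule: infinite_finite_induct) (auto intro: Ck_on_const[OF U] Ck_on_add[OF U])

section \<open>Functions of a single coordinate\<close>

lemma continuous_map_coordinate:
  assumes "continuous_on S \<phi>" "p \<in> {1..m}" "\<And>x. x \<in> U \<Longrightarrow> x p \<in> S"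
  shows "continuous_map (subtopology (powertop_real {1..m}) U) euclideanreal (\<lambda>x. \<phi> (x p))"
proof -
  have "continuous_map (subtopology (powertop_real {1..m}) U) (top_of_set S) (\<lambda>x. x p)"
    using assms(2,3)
    by (auto simp: continuous_map_in_subtopology simp del: One_nat_def
        intro!: continuous_map_from_subtopology continuous_map_product_projection)
  from continuous_map_compose[OF this, of euclideanreal \<phi>] assms(1) show ?thesis
    by (simp add: o_def)
qed

text \<open>The only nonzero partial derivative is the one in direction \<open>p\<close>, and it
  again depends on \<open>x p\<close> alone. Regularity thus rises by one order per application; two
  applications handle a \<open>C2_real\<close> function.\<close>

lemma Ck_on_Suc_coordinate:
  assumes U: "openin (powertop_real {1..m}) U"
    and p: "p \<in> {1..m}" "\<And>x. x \<in> U \<Longrightarrow> x p \<in> S"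
    and D: "\<And>t. t \<in> S \<Longrightarrow> (\<phi> has_real_derivative \<phi>' t) (at t)"
    and C: "Ck_on r m U (\<lambda>x. \<phi>' (x p))"
  shows "Ck_on (Suc r) m U (\<lambda>x. \<phi> (x p))"
proof (rule Ck_on_SucI[OF U, where f' = "\<lambda>i x. if i = p then \<phi>' (x p) else 0"])
  show "continuous_map (subtopology (powertop_real {1..m}) U) euclideanreal (\<lambda>x. \<phi> (x p))"
    using continuous_map_coordinate[of S \<phi> p m U] p D
    by (meson DERIV_isCont continuous_at_imp_continuous_on)
  show "((\<lambda>t. \<phi> ((x(i := t)) p)) has_real_derivative (if i = p then \<phi>' (x p) else 0)) (at (x i))"
    if "i \<in> {1..m}" "x \<in> U" for i x
    using D p(2)[OF that(2)] by (cases "i = p") auto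
  show "Ck_on r m U (\<lambda>x. if i = p then \<phi>' (x p) else 0)" for i
    using C Ck_on_const[OF U] by (cases "i = p") auto
qed

lemma Ck_on_C2_coordinate:
  assumes U: "openin (powertop_real {1..m}) U"
    and p: "p \<in> {1..m}" "\<And>x. x \<in> U \<Longrightarrow> x p \<in> S"
    and "C2_real S \<phi>"
  shows "Ck_on 2 m U (\<lambda>x. \<phi> (x p))"
proof -
  have "Ck_on 0 m U (\<lambda>x. deriv (deriv \<phi>) (x p))"
    using assms(4) continuous_map_coordinate[of S _ p m U] p by (simp add: C2_real_def)
  then have "Ck_on (Suc (Suc 0)) m U (\<lambda>x. \<phi> (x p))"
    using assms(4)
    using p
    by (intro Ck_on_Suc_coordinate[OF U, where S = S and \<phi>' = "deriv \<phi>"]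
        Ck_on_Suc_coordinate[OF U, where S = S and \<phi>' = "deriv (deriv \<phi>)"])
       (simp_all add: C2_real_def DERIV_deriv_iff_real_differentiable)
  then show ?thesis
    by (simp add: numeral_2_eq_2)
qed

lemma deriv_linear_real: "deriv (\<lambda>t. c * t :: real) = (\<lambda>t. c)"
  by (rule ext, rule DERIV_imp_deriv) (auto intro!: derivative_eq_intros)

lemma C2_real_linear: "C2_real S (\<lambda>t. c * t)"
  by (simp add: C2_real_def deriv_linear_real)

lemma Ck_on_coordinate:
  assumes "openin (powertop_real {1..m}) U" "p \<in> {1..m}"
  shows "Ck_on 2 m U (\<lambda>x. x p)"
  using Ck_on_C2_coordinate[OF assms(1,2) _ C2_real_linear, of UNIV 1] by simp

section \<open>Equal linear summands give a reduction\<close>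

text \<open>Prepares the passage from \<open>n\<close> to \<open>n - 1\<close> variables: once
  positions 1 and 2 are merged into one, position \<open>m + 1\<close> becomes position
  \<open>m\<close>.\<close>

lemma sum_merge_two:
  fixes \<psi> :: "nat \<Rightarrow> real"
  assumes "n \<ge> 3" "\<sigma> permutes {1..n}"
  shows "(\<Sum>p=1..n. \<psi> p) = \<psi> (\<sigma> 1) + \<psi> (\<sigma> 2) + (\<Sum>m=2..n - 1. \<psi> (\<sigma> (m + 1)))"
proof -
  have "(\<Sum>p=1..n. \<psi> p) = (\<Sum>p=1..n. \<psi> (\<sigma> p))"
    using sum.permute[OF assms(2), of \<psi>] by (simp add: o_def)
  also have "\<dots> = \<psi> (\<sigma> 1) + (\<psi> (\<sigma> 2) + (\<Sum>p=3..n. \<psi> (\<sigma> p)))"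
    using assms(1) by (simp add: sum.atLeast_Suc_atMost numeral_2_eq_2 numeral_3_eq_3)
  also have "(\<Sum>p=3..n. \<psi> (\<sigma> p)) = (\<Sum>p=2 + 1..(n - 1) + 1. \<psi> (\<sigma> p))"
    using assms(1) by simp
  also have "\<dots> = (\<Sum>m=2..n - 1. \<psi> (\<sigma> (m + 1)))"
    by (rule sum.shift_bounds_cl_nat_ivl)
  finally show ?thesis
    by simp
qed

text \<open>The outer transposition sends 1 to \<open>i\<close>. The inner one brings the preimage
  of \<open>j\<close> to position 2 and leaves 1 alone, since that preimage is not 1.\<close>

lemma permutation_first_two:
  assumes "i \<in> {1..n}" "j \<in> {1..n}" "i \<noteq> j"
  obtains \<sigma> where "\<sigma> permutes {1..n}" "\<sigma> 1 = i" "\<sigma> (2 :: nat) = j"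
proof
  let ?\<tau> = "Transposition.transpose 1 i"
  have 2: "?\<tau> j \<in> {1..n}" "2 \<in> {1..n}" "?\<tau> j \<noteq> 1"
    using assms by (auto simp: Transposition.transpose_def)
  show "?\<tau> \<circ> Transposition.transpose 2 (?\<tau> j) permutes {1..n}"
    using assms 2 by (intro permutes_compose permutes_swap_id) auto
  show "(?\<tau> \<circ> Transposition.transpose 2 (?\<tau> j)) 1 = i" "(?\<tau> \<circ> Transposition.transpose 2 (?\<tau> j)) 2 = j"
    using 2(3) by (auto simp: transpose_apply_other)
qed

text \<open>Since c x_i + c x_j = c (x_i + x_j), numerator and denominator both depend on x_i and
  x_j only through their sum. So k = 2, \<open>h\<close> is addition, and \<open>g\<close> is a
  quotient of the same shape in \<open>n - 1\<close> variables.\<close>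

lemma reducible_if_equal_linear:
  assumes n: "n \<ge> 3" and I: "\<And>p. p \<in> {1..n} \<Longrightarrow> open_interval (I p)"
    and f: "defined_by n I F f"
    and ij: "i \<in> {1..n}" "j \<in> {1..n}" "i \<noteq> j"
    and lin: "\<And>t. t \<in> I i \<Longrightarrow> f i t = c * t" "\<And>t. t \<in> I j \<Longrightarrow> f j t = c * t"
  shows "reducible n I F"
proof -
  obtain \<sigma> where \<sigma>: "\<sigma> permutes {1..n}" "\<sigma> 1 = i" "\<sigma> 2 = j"
    by (rule permutation_first_two[OF ij])
  have \<sigma>_mem: "\<sigma> p \<in> {1..n}" if "p \<in> {1..n}" for p
    using permutes_in_image[OF \<sigma>(1)] that by blast
  \<comment> \<open>The domain of \<open>g\<close> is a box whose first side is the Minkowski sum of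
    \<open>I i\<close> and \<open>I j\<close>, open as a union of translates of
    \<open>I j\<close>.\<close>
  define J where "J m = (if m = 1 then {a + b |a b. a \<in> I i \<and> b \<in> I j} else I (\<sigma> (m + 1)))" for m
  define \<phi> where "\<phi> m = (if m = 1 then (\<lambda>t. c * t) else f (\<sigma> (m + 1)))" for m
  define V where "V = Pi\<^sub>E {1..n - 1} J"
  define g where "g y = (\<Sum>m=1..n - 1. \<phi> m (y m)) * inverse (\<Sum>m=1..n - 1. y m)" for y
  define h where "h u = u 1 + u (2::nat)" for u :: "nat \<Rightarrow> real"
  have split1: "(\<Sum>m=1..n - 1. \<psi> m) = \<psi> 1 + (\<Sum>m=2..n - 1. \<psi> m)" for \<psi> :: "nat \<Rightarrow> real"
    using n by (simp add: sum.atLeast_Suc_atMost numeral_2_eq_2)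
  have J: "open (J m)" if "m \<in> {1..n - 1}" for m
  proof (cases "m = 1")
    case True
    have "open (\<Union>a\<in>I i. (+) a ` I j)"
      using I[OF ij(2)] by (intro open_UN ballI open_translation) (auto simp: open_interval_def)
    also have "(\<Union>a\<in>I i. (+) a ` I j) = J m"
      using True by (auto simp: J_def)
    finally show ?thesis .
  next
    case False
    then show ?thesis
      using I[OF \<sigma>_mem[of "m + 1"]] that by (auto simp: J_def open_interval_def)
  qed
  \<comment> \<open>The form with \<open>n + 1 - 2\<close> matches the definition of
    \<open>reducible\<close> at k = 2; the one with \<open>n - 1\<close> is used for the
    calculus.\<close>
  have V: "openin (powertop_real {1..n + 1 - 2}) V"
    unfolding V_def using J by (simp add: openin_PiE)
  have V': "openin (powertop_real {1..n - 1}) V"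
    unfolding V_def using J by (simp add: openin_PiE)
  \<comment> \<open>For \<open>g\<close> to be smooth its denominator must not vanish anywhere on
    \<open>V\<close>. Each \<open>y\<close> in \<open>V\<close> comes from a point \<open>x\<close>
    of the original box with the same coordinate sum, and that sum is nonzero.\<close>
  have nz: "(\<Sum>m=1..n - 1. y m) \<noteq> 0" if y: "y \<in> V" for y
  proof -
    have "y 1 \<in> J 1"
      using y n by (auto simp: V_def)
    then obtain a b where ab: "a \<in> I i" "b \<in> I j" "y 1 = a + b"
      by (auto simp: J_def)
    \<comment> \<open>The first entry of \<open>y\<close> is split into \<open>a\<close> and
      \<open>b\<close>. Any other coordinate \<open>p\<close> has position
      \<open>inv \<sigma> p\<close> at least 3 in the renumbering, hence one less in
      \<open>y\<close>.\<close>
    define x where "x = (\<lambda>p\<in>{1..n}. if p = i then a else if p = j then b else y (inv \<sigma> p - 1))"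
    have inv: "inv \<sigma> p \<in> {1..n}" "\<sigma> (inv \<sigma> p) = p" if "p \<in> {1..n}" for p
      using permutes_in_image[OF permutes_inv[OF \<sigma>(1)]] permutes_inverses[OF \<sigma>(1)] that by auto
    have xI: "x p \<in> I p" if p: "p \<in> {1..n}" for p
    proof (cases "p = i \<or> p = j")
      case True
      then show ?thesis
        using p ab by (auto simp: x_def)
    next
      case False
      then have "inv \<sigma> p \<noteq> 1" "inv \<sigma> p \<noteq> 2" "inv \<sigma> p \<noteq> 0"
        using inv[OF p] \<sigma> by auto
      then have q: "inv \<sigma> p - 1 \<in> {1..n - 1}" "inv \<sigma> p - 1 \<noteq> 1" "inv \<sigma> p - 1 + 1 = inv \<sigma> p"
        using inv[OF p] by auto
      then have "y (inv \<sigma> p - 1) \<in> J (inv \<sigma> p - 1)"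
        using y by (auto simp: V_def)
      then show ?thesis
        using False p q inv[OF p] by (simp add: x_def J_def)
    qed
    then have "x \<in> Pi\<^sub>E {1..n} I"
      by (auto simp: x_def)
    then have "(\<Sum>p=1..n. x p) \<noteq> 0"
      using f by (auto simp: defined_by_def)
    moreover have "x (\<sigma> (m + 1)) = y m" if "m \<in> {2..n - 1}" for m
    proof -
      have "\<sigma> (m + 1) \<noteq> \<sigma> 1" "\<sigma> (m + 1) \<noteq> \<sigma> 2"
        using that by (auto simp: inj_eq[OF permutes_inj[OF \<sigma>(1)]])
      moreover have "\<sigma> (m + 1) \<in> {1..n}"
        using that by (intro \<sigma>_mem) auto
      ultimately show ?thesis
        using \<sigma> permutes_inverses[OF \<sigma>(1)] by (simp add: x_def)
    qed
    moreover have "x i = a" "x j = b"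
      using ij by (auto simp: x_def)
    ultimately show ?thesis
      using ab by (simp add: sum_merge_two[OF n \<sigma>(1)] split1 \<sigma> del: One_nat_def)
  qed
  have "Ck_on 2 (n - 1) V g"
    unfolding g_def
  proof (intro Ck_on_mult[OF V'] Ck_on_inverse[OF V'] Ck_on_sum[OF V'] nz)
    fix m assume m: "m \<in> {1..n - 1}"
    show "Ck_on 2 (n - 1) V (\<lambda>x. x m)"
      by (rule Ck_on_coordinate[OF V' m])
    have "C2_real (J m) (\<phi> m)"
      using f \<sigma>_mem[of "m + 1"] m
      by (auto simp: J_def \<phi>_def C2_real_linear defined_by_def)
    then show "Ck_on 2 (n - 1) V (\<lambda>x. \<phi> m (x m))"
      by (rule Ck_on_C2_coordinate[OF V' m, rotated]) (use m in \<open>auto simp: V_def\<close>)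
  qed
  then have g: "Ck_on 2 (n + 1 - 2) V g"
    by simp
  have W: "openin (powertop_real {1..2}) (\<Pi>\<^sub>E m\<in>{1..2}. I (\<sigma> m))"
    using I \<sigma>_mem n by (auto simp: openin_PiE open_interval_def)
  have h: "Ck_on 2 2 (\<Pi>\<^sub>E m\<in>{1..2}. I (\<sigma> m)) h"
    unfolding h_def using Ck_on_coordinate[OF W] by (intro Ck_on_add[OF W]) auto
  have "let y = (\<lambda>m\<in>{1..n + 1 - 2}.
                 if m = 1 then h (\<lambda>j\<in>{1..2}. x (\<sigma> j)) else x (\<sigma> (2 + m - 1)))
        in y \<in> V \<and> F x = g y" if x: "x \<in> Pi\<^sub>E {1..n} I" for x
  proof -
    define y where "y = (\<lambda>m\<in>{1..n + 1 - 2}.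
                 if m = 1 then h (\<lambda>j\<in>{1..2}. x (\<sigma> j)) else x (\<sigma> (2 + m - 1)))"
    have xI: "x p \<in> I p" if "p \<in> {1..n}" for p
      using x that by auto
    have y1: "y 1 = x i + x j"
      using n \<sigma> by (auto simp: y_def h_def simp del: One_nat_def)
    have ym: "y m = x (\<sigma> (m + 1))" if "m \<in> {2..n - 1}" for m
      using that by (auto simp: y_def)
    have "y m \<in> J m" if "m \<in> {1..n - 1}" for m
      using that y1 ym[of m] xI[OF ij(1)] xI[OF ij(2)] xI[OF \<sigma>_mem[of "m + 1"]]
      by (cases "m = 1") (auto simp: J_def simp del: One_nat_def)
    then have "y \<in> V"
      by (auto simp: V_def y_def)
    moreover have "F x = (\<Sum>p=1..n. f p (x p)) / (\<Sum>p=1..n. x p)"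
      using f x by (auto simp: defined_by_def)
    moreover have "(\<Sum>p=1..n. x p) = (\<Sum>m=1..n - 1. y m)"
      using ym y1 by (simp add: sum_merge_two[OF n \<sigma>(1)] split1 \<sigma> del: One_nat_def)
    moreover have "(\<Sum>p=1..n. f p (x p)) = (\<Sum>m=1..n - 1. \<phi> m (y m))"
      using ym y1 lin xI[OF ij(1)] xI[OF ij(2)]
      by (simp add: sum_merge_two[OF n \<sigma>(1)] split1 \<sigma> \<phi>_def algebra_simps del: One_nat_def)
    ultimately show ?thesis
      unfolding Let_def y_def[symmetric] by (simp add: g_def divide_inverse)
  qed
  then show ?thesis
    unfolding reducible_def
    by (intro exI[of _ \<sigma>] exI[of _ 2] exI[of _ h] exI[of _ g] exI[of _ V])
       (use n \<sigma>(1) h V g in auto)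
qed

section \<open>A reduction gives equal linear summands\<close>

lemma PiE_fun_upd_mem: "x \<in> Pi\<^sub>E A I \<Longrightarrow> i \<in> A \<Longrightarrow> t \<in> I i \<Longrightarrow> x(i := t) \<in> Pi\<^sub>E A I"
  by (auto simp: PiE_def Pi_def extensional_def)

text \<open>Isolates the dependence on one coordinate, so that numerator and denominator can be
  differentiated along it.\<close>

lemma sum_fun_upd:
  fixes \<phi> :: "'a \<Rightarrow> 'b \<Rightarrow> real"
  assumes "finite A" "l \<in> A"
  shows "(\<Sum>p\<in>A. \<phi> p ((x(l := t)) p)) = (\<Sum>p\<in>A. \<phi> p (x p)) + (\<phi> l t - \<phi> l (x l))"
proof -
  have "(\<Sum>p\<in>A - {l}. \<phi> p ((x(l := t)) p)) = (\<Sum>p\<in>A - {l}. \<phi> p (x p))"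
    by (rule sum.cong) auto
  then show ?thesis
    by (simp add: sum.remove[OF assms])
qed

text \<open>By the chain rule the derivative of \<open>F\<close> in an inner variable is the
  derivative of \<open>g\<close> in its first slot, the common factor \<open>G\<close>, times a
  partial derivative of \<open>h\<close>. The latter does not see the outer variable. The choice is
  \<open>\<sigma> 1\<close>, \<open>\<sigma> 2\<close> for \<open>i\<close>, \<open>j\<close> and
  \<open>\<sigma> n\<close> for \<open>l\<close>.\<close>

lemma reducible_partial_derivs:
  assumes "n \<ge> 3" and I: "\<And>p. p \<in> {1..n} \<Longrightarrow> open (I p)"
    and "reducible n I F"
  obtains i j l G A B where
    "i \<in> {1..n}" "j \<in> {1..n}" "l \<in> {1..n}" "i \<noteq> j" "l \<noteq> i" "l \<noteq> j"
    "\<And>x. x \<in> Pi\<^sub>E {1..n} I \<Longrightarrow> partial_deriv i F x = G x * A x"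
    "\<And>x. x \<in> Pi\<^sub>E {1..n} I \<Longrightarrow> partial_deriv j F x = G x * B x"
    "\<And>x t. A (x(l := t)) = A x" "\<And>x t. B (x(l := t)) = B x"
proof -
  from assms(3) obtain \<sigma> k h g V where
    \<sigma>: "\<sigma> permutes {1..n}" and k: "2 \<le> k" "k \<le> n - 1" and
    h: "Ck_on 2 k (\<Pi>\<^sub>E m\<in>{1..k}. I (\<sigma> m)) h" and
    g: "Ck_on 2 (n + 1 - k) V g" and
    dec: "\<forall>x\<in>Pi\<^sub>E {1..n} I.
           let y = (\<lambda>m\<in>{1..n + 1 - k}.
                      if m = 1 then h (\<lambda>j\<in>{1..k}. x (\<sigma> j)) else x (\<sigma> (k + m - 1)))
           in y \<in> V \<and> F x = g y"
    unfolding reducible_def by (elim exE conjE) (rule that)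
  define u where "u x = (\<lambda>j\<in>{1..k}. x (\<sigma> j))" for x :: "nat \<Rightarrow> real"
  define y where "y x = (\<lambda>m\<in>{1..n + 1 - k}. if m = 1 then h (u x) else x (\<sigma> (k + m - 1)))" for x
  have y: "y x \<in> V" "F x = g (y x)" if "x \<in> Pi\<^sub>E {1..n} I" for x
    using bspec[OF dec that] by (simp_all only: y_def u_def Let_def)
  have inj: "\<sigma> p = \<sigma> q \<longleftrightarrow> p = q" for p q
    using permutes_inj[OF \<sigma>] by (auto simp: inj_eq)
  have \<sigma>_mem: "\<sigma> p \<in> {1..n}" if "p \<in> {1..n}" for p
    using permutes_in_image[OF \<sigma>] that by blast
  have chain: "partial_deriv (\<sigma> a) F x = partial_deriv 1 g (y x) * partial_deriv a h (u x)"
    if a: "a \<in> {1..k}" and x: "x \<in> Pi\<^sub>E {1..n} I" for a x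
  proof -
    have an: "\<sigma> a \<in> {1..n}"
      using a k by (intro \<sigma>_mem) auto
    have u_upd: "u (x(\<sigma> a := t)) = (u x)(a := t)" for t
      using a by (auto simp: u_def inj)
    have y_upd: "y (x(\<sigma> a := t)) = (y x)(1 := h ((u x)(a := t)))" for t
      using a k by (auto simp: y_def u_upd inj fun_eq_iff)
    have ua: "u x a = x (\<sigma> a)"
      using a by (simp add: u_def)
    \<comment> \<open>The trivial update puts the base point into the form in which the chain rule
      expects it.\<close>
    have y1: "y x 1 = h ((u x)(a := u x a))"
      using k by (auto simp: y_def)
    have "u x \<in> (\<Pi>\<^sub>E m\<in>{1..k}. I (\<sigma> m))"
      using x \<sigma>_mem k by (fastforce simp: u_def)
    then have Dh: "((\<lambda>t. h ((u x)(a := t))) has_real_derivative partial_deriv a h (u x)) (at (u x a))"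
      using h a by (intro Ck_on_DERIV[of 1]) (auto simp: numeral_2_eq_2)
    have Dg: "((\<lambda>s. g ((y x)(1 := s))) has_real_derivative partial_deriv 1 g (y x)) (at (y x 1))"
      using g y(1)[OF x] k by (intro Ck_on_DERIV[of 1]) (auto simp: numeral_2_eq_2)
    have "((\<lambda>t. g ((y x)(1 := h ((u x)(a := t))))) has_real_derivative
        partial_deriv 1 g (y x) * partial_deriv a h (u x)) (at (u x a))"
      using DERIV_chain2[OF Dg[unfolded y1] Dh] .
    then have "((\<lambda>t. F (x(\<sigma> a := t))) has_real_derivative
        partial_deriv 1 g (y x) * partial_deriv a h (u x)) (at (x (\<sigma> a)))"
      unfolding ua
    proof (rule has_field_derivative_transform_within_open[OF _ I[OF an]])
      show "x (\<sigma> a) \<in> I (\<sigma> a)"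
        using x an by auto
      show "g ((y x)(1 := h ((u x)(a := t)))) = F (x(\<sigma> a := t))" if "t \<in> I (\<sigma> a)" for t
        using y(2)[OF PiE_fun_upd_mem[OF x an that]] by (simp only: y_upd)
    qed
    then show ?thesis
      by (simp add: partial_deriv_def DERIV_imp_deriv)
  qed
  \<comment> \<open>Position \<open>n\<close> lies outside the first \<open>k\<close> because
    \<open>k\<close> is at most \<open>n - 1\<close>.\<close>
  have outer: "u (x(\<sigma> n := t)) = u x" for x t
    using k by (auto simp: u_def inj fun_eq_iff)
  show ?thesis
  proof
    show "\<sigma> 1 \<in> {1..n}" "\<sigma> 2 \<in> {1..n}" "\<sigma> n \<in> {1..n}"
      using assms(1) by (intro \<sigma>_mem; simp)+
    show "\<sigma> 1 \<noteq> \<sigma> 2" "\<sigma> n \<noteq> \<sigma> 1" "\<sigma> n \<noteq> \<sigma> 2"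
      using assms(1) by (auto simp: inj)
    show "partial_deriv (\<sigma> 1) F x = partial_deriv 1 g (y x) * partial_deriv 1 h (u x)"
      "partial_deriv (\<sigma> 2) F x = partial_deriv 1 g (y x) * partial_deriv 2 h (u x)"
      if "x \<in> Pi\<^sub>E {1..n} I" for x
      using chain that k by auto
    show "partial_deriv 1 h (u (x(\<sigma> n := t))) = partial_deriv 1 h (u x)"
      "partial_deriv 2 h (u (x(\<sigma> n := t))) = partial_deriv 2 h (u x)" for x t
      by (simp_all only: outer)
  qed
qed

section \<open>Derivatives of the summands of a reducible quotient\<close>

text \<open>This is the quotient rule along the \<open>i\<close>-th coordinate. \<open>F\<close> is
  a quotient only on the box, so the derivative is transferred along the open interval
  \<open>I i\<close>.\<close>

lemma partial_deriv_quotient: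
  assumes I: "open (I i)" and f: "defined_by n I F f"
    and i: "i \<in> {1..n}" and x: "x \<in> Pi\<^sub>E {1..n} I"
  shows "partial_deriv i F x =
    (deriv (f i) (x i) * (\<Sum>p=1..n. x p) - (\<Sum>p=1..n. f p (x p))) / (\<Sum>p=1..n. x p)\<^sup>2"
proof -
  let ?N = "\<Sum>p=1..n. f p (x p)" and ?S = "\<Sum>p=1..n. x p"
  have S: "?S \<noteq> 0"
    using f x by (auto simp: defined_by_def)
  have xi: "x i \<in> I i"
    using x i by auto
  have Df: "(f i has_real_derivative deriv (f i) (x i)) (at (x i))"
    using f i xi by (auto simp: defined_by_def C2_real_def DERIV_deriv_iff_real_differentiable)
  have "((\<lambda>t. (?N + (f i t - f i (x i))) / (?S + (t - x i))) has_real_derivative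
      (deriv (f i) (x i) * ?S - ?N) / ?S\<^sup>2) (at (x i))"
    using S by (auto intro!: derivative_eq_intros Df simp: power2_eq_square)
  then have "((\<lambda>t. F (x(i := t))) has_real_derivative
      (deriv (f i) (x i) * ?S - ?N) / ?S\<^sup>2) (at (x i))"
  proof (rule has_field_derivative_transform_within_open[OF _ I xi])
    fix t assume "t \<in> I i"
    then have "F (x(i := t)) = (\<Sum>p=1..n. f p ((x(i := t)) p)) / (\<Sum>p=1..n. (x(i := t)) p)"
      using f PiE_fun_upd_mem[OF x i] unfolding defined_by_def by blast
    then show "(?N + (f i t - f i (x i))) / (?S + (t - x i)) = F (x(i := t))"
      using sum_fun_upd[OF _ i, of f x t] sum_fun_upd[OF _ i, of "\<lambda>_ s. s" x t]
      by (simp del: fun_upd_apply)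
  qed
  then show ?thesis
    by (simp add: partial_deriv_def DERIV_imp_deriv)
qed

text \<open>Eliminating \<open>G\<close> leaves an identity in which \<open>A\<close> and
  \<open>B\<close> are constant along \<open>x l\<close>. It and its derivative in that direction
  are two linear relations between \<open>A x\<close> and \<open>B x\<close>, which force these to
  be equal.\<close>

lemma reducible_derivs_equal:
  assumes I: "\<And>p. p \<in> {1..n} \<Longrightarrow> open (I p)"
    and f: "defined_by n I F f"
    and nz: "\<And>p x. p \<in> {1..n} \<Longrightarrow> x \<in> Pi\<^sub>E {1..n} I \<Longrightarrow> partial_deriv p F x \<noteq> 0"
    and ijl: "i \<in> {1..n}" "j \<in> {1..n}" "l \<in> {1..n}" "l \<noteq> i" "l \<noteq> j"
    and Fi: "\<And>x. x \<in> Pi\<^sub>E {1..n} I \<Longrightarrow> partial_deriv i F x = G x * A x"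
    and Fj: "\<And>x. x \<in> Pi\<^sub>E {1..n} I \<Longrightarrow> partial_deriv j F x = G x * B x"
    and indep: "\<And>x t. A (x(l := t)) = A x" "\<And>x t. B (x(l := t)) = B x"
    and x: "x \<in> Pi\<^sub>E {1..n} I"
  shows "deriv (f i) (x i) = deriv (f j) (x j)"
proof -
  define N where "N x = (\<Sum>p=1..n. f p (x p))" for x
  define S where "S x = (\<Sum>p=1..n. x p)" for x :: "nat \<Rightarrow> real"
  define p q r where "p = deriv (f i) (x i)" and "q = deriv (f j) (x j)" and "r = deriv (f l) (x l)"
  have S: "S z \<noteq> 0" if "z \<in> Pi\<^sub>E {1..n} I" for z
    using f that by (auto simp: defined_by_def S_def)
  have F: "partial_deriv m F z = (deriv (f m) (z m) * S z - N z) / (S z)\<^sup>2"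
    if "m \<in> {1..n}" "z \<in> Pi\<^sub>E {1..n} I" for m z
    using partial_deriv_quotient[OF I[OF that(1)] f that] by (simp add: N_def S_def)
  have ratio: "(deriv (f i) (z i) * S z - N z) * B z = (deriv (f j) (z j) * S z - N z) * A z"
    if z: "z \<in> Pi\<^sub>E {1..n} I" for z
  proof -
    have "partial_deriv i F z * B z = partial_deriv j F z * A z"
      using Fi[OF z] Fj[OF z] by simp
    then show ?thesis
      using S[OF z] F[OF ijl(1) z] F[OF ijl(2) z] by (simp add: field_simps)
  qed
  have upd: "N (x(l := t)) = N x + (f l t - f l (x l))" "S (x(l := t)) = S x + (t - x l)" for t
    using sum_fun_upd[OF _ ijl(3), of f x t] sum_fun_upd[OF _ ijl(3), of "\<lambda>_ s. s" x t]
    by (simp_all add: N_def S_def del: fun_upd_apply)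
  have xl: "x l \<in> I l"
    using x ijl by auto
  have Df: "(f l has_real_derivative r) (at (x l))"
    using f ijl xl by (auto simp: r_def defined_by_def C2_real_def DERIV_deriv_iff_real_differentiable)
  \<comment> \<open>This is the difference of the two sides of \<open>ratio\<close> along the line
    in direction \<open>l\<close>. There \<open>p\<close>, \<open>q\<close>, \<open>A x\<close> and
    \<open>B x\<close> stay fixed, as \<open>l\<close> differs from \<open>i\<close> and
    \<open>j\<close>.\<close>
  define \<Phi> where "\<Phi> t = (p * (S x + (t - x l)) - (N x + (f l t - f l (x l)))) * B x
      - (q * (S x + (t - x l)) - (N x + (f l t - f l (x l)))) * A x" for t
  have "\<Phi> t = 0" if "t \<in> I l" for t
    using ratio[OF PiE_fun_upd_mem[OF x ijl(3) that]] ijl(4,5)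
    by (simp add: \<Phi>_def p_def q_def indep upd)
  then have "(\<Phi> has_real_derivative 0) (at (x l))"
    by (intro has_field_derivative_transform_within_open[OF DERIV_const I[OF ijl(3)] xl]) auto
  moreover have "(\<Phi> has_real_derivative (p - r) * B x - (q - r) * A x) (at (x l))"
    unfolding \<Phi>_def by (auto intro!: derivative_eq_intros Df)
  ultimately have 1: "(p - r) * B x - (q - r) * A x = 0"
    by (rule DERIV_unique[rotated])
  have 2: "(p * S x - N x) * B x = (q * S x - N x) * A x"
    using ratio[OF x] by (simp add: p_def q_def)
  \<comment> \<open>Relation 2 minus \<open>S x\<close> times relation 1 eliminates \<open>p\<close>
    and \<open>q\<close>. The factor that remains is the numerator of the derivative of
    \<open>F\<close> in direction \<open>l\<close>, hence nonzero.\<close>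
  have "(r * S x - N x) * (B x - A x) =
      ((p * S x - N x) * B x - (q * S x - N x) * A x) - S x * ((p - r) * B x - (q - r) * A x)"
    by (simp add: algebra_simps)
  then have "(r * S x - N x) * (B x - A x) = 0"
    using 1 2 by simp
  moreover have "r * S x - N x \<noteq> 0"
    using nz[OF ijl(3) x] F[OF ijl(3) x] by (auto simp: r_def)
  ultimately have "A x = B x"
    by simp
  moreover have "A x \<noteq> 0"
    using nz[OF ijl(1) x] Fi[OF x] by auto
  ultimately show ?thesis
    using 2 S[OF x] by (simp add: p_def q_def)
qed

section \<open>Affine summands and the shift of their constants\<close>

lemma affine_if_deriv_const:
  fixes f :: "real \<Rightarrow> real"
  assumes "is_interval S" "\<And>t. t \<in> S \<Longrightarrow> (f has_real_derivative c) (at t)"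
  obtains a where "\<And>t. t \<in> S \<Longrightarrow> f t = c * t + a"
proof -
  have "\<exists>a. \<forall>t\<in>S. f t - c * t = a"
  proof (rule has_field_derivative_zero_constant)
    show "convex S"
      using assms(1) by (rule is_interval_convex)
    show "((\<lambda>t. f t - c * t) has_real_derivative 0) (at t within S)" if "t \<in> S" for t
      using DERIV_subset[OF assms(2)[OF that], of S]
      by (auto intro!: derivative_eq_intros)
  qed
  then show ?thesis
    using that by (metis add.commute diff_eq_eq)
qed

text \<open>The first derivatives are compared only on \<open>S\<close>, where \<open>\<phi>\<close>
  is known to be differentiable; openness of \<open>S\<close> carries their equality over to the
  second derivatives.\<close>

lemma C2_real_add_const:
  assumes "open S" "C2_real S \<phi>"
  shows "C2_real S (\<lambda>t. \<phi> t + a)"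
proof -
  have D: "((\<lambda>t. \<phi> t + a) has_real_derivative deriv \<phi> t) (at t)" if "t \<in> S" for t
    using assms that
    by (auto intro!: derivative_eq_intros simp: C2_real_def DERIV_deriv_iff_real_differentiable)
  have eq1: "deriv \<phi> t = deriv (\<lambda>t. \<phi> t + a) t" if "t \<in> S" for t
    using DERIV_imp_deriv[OF D[OF that]] by simp
  have D2: "(deriv (\<lambda>t. \<phi> t + a) has_real_derivative deriv (deriv \<phi>) t) (at t)" if "t \<in> S" for t
    by (rule has_field_derivative_transform_within_open[OF _ assms(1) that eq1])
       (use assms that in \<open>auto simp: C2_real_def DERIV_deriv_iff_real_differentiable\<close>)
  have eq2: "deriv (deriv \<phi>) t = deriv (deriv (\<lambda>t. \<phi> t + a)) t" if "t \<in> S" for t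
    using DERIV_imp_deriv[OF D2[OF that]] by simp
  have "continuous_on S (deriv (deriv (\<lambda>t. \<phi> t + a)))"
    using assms(2) continuous_on_cong[where t = S, OF refl eq2] by (simp add: C2_real_def)
  then show ?thesis
    using D D2 real_differentiable_def unfolding C2_real_def by blast
qed

text \<open>Equal derivatives at independent arguments are constant, so \<open>f i\<close> and
  \<open>f j\<close> are affine with a common slope. Their constant terms need not vanish, which is
  why another representation \<open>f'\<close> of the same \<open>F\<close> is produced.\<close>

lemma equal_linear_if_reducible:
  assumes n: "n \<ge> 3" and Q: "local_quasigroup n I F" and f: "defined_by n I F f"
    and red: "reducible n I F"
  obtains f' i j c where "defined_by n I F f'" "i \<in> {1..n}" "j \<in> {1..n}" "i \<noteq> j"
    "\<forall>t\<in>I i. f' i t = c * t" "\<forall>t\<in>I j. f' j t = c * t"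
proof -
  have I: "open (I p)" "is_interval (I p)" "I p \<noteq> {}" if "p \<in> {1..n}" for p
    using Q that by (auto simp: local_quasigroup_def open_interval_def)
  have nz: "partial_deriv p F x \<noteq> 0" if "p \<in> {1..n}" "x \<in> Pi\<^sub>E {1..n} I" for p x
    using Q that by (auto simp: local_quasigroup_def)
  obtain i j l G A B where ijl: "i \<in> {1..n}" "j \<in> {1..n}" "l \<in> {1..n}" "i \<noteq> j" "l \<noteq> i" "l \<noteq> j"
    and D: "\<And>x. x \<in> Pi\<^sub>E {1..n} I \<Longrightarrow> partial_deriv i F x = G x * A x"
    "\<And>x. x \<in> Pi\<^sub>E {1..n} I \<Longrightarrow> partial_deriv j F x = G x * B x"
    "\<And>x t. A (x(l := t)) = A x" "\<And>x t. B (x(l := t)) = B x"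
    using reducible_partial_derivs[OF n I(1) red] by metis
  obtain x where x: "x \<in> Pi\<^sub>E {1..n} I"
    using I(3) by (metis PiE_eq_empty_iff all_not_in_conv)
  \<comment> \<open>A fixed point of the box is updated at \<open>i\<close> and \<open>j\<close>
    separately, so \<open>s\<close> and \<open>t\<close> vary independently.\<close>
  have eq: "deriv (f i) s = deriv (f j) t" if st: "s \<in> I i" "t \<in> I j" for s t
    using reducible_derivs_equal[OF I(1) f nz ijl(1-3,5,6) D, of "x(i := s, j := t)"]
      PiE_fun_upd_mem[OF PiE_fun_upd_mem[OF x ijl(1) st(1)] ijl(2) st(2)] ijl(4)
    by simp
  define c where "c = deriv (f i) (x i)"
  have xI: "x i \<in> I i" "x j \<in> I j"
    using x ijl by auto
  have der: "(f p has_real_derivative deriv (f p) t) (at t)" if "p \<in> {1..n}" "t \<in> I p" for p t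
    using f that by (auto simp: defined_by_def C2_real_def DERIV_deriv_iff_real_differentiable)
  have "(f i has_real_derivative c) (at t)" if "t \<in> I i" for t
    using der[OF ijl(1) that] eq[OF that xI(2)] eq[OF xI] by (simp add: c_def)
  then obtain a where a: "\<And>t. t \<in> I i \<Longrightarrow> f i t = c * t + a"
    using affine_if_deriv_const[OF I(2)[OF ijl(1)]] by blast
  have "(f j has_real_derivative c) (at t)" if "t \<in> I j" for t
    using der[OF ijl(2) that] eq[OF xI(1) that] by (simp add: c_def)
  then obtain b where b: "\<And>t. t \<in> I j \<Longrightarrow> f j t = c * t + b"
    using affine_if_deriv_const[OF I(2)[OF ijl(2)]] by blast
  \<comment> \<open>The offsets cancel the constant terms of \<open>f i\<close> and
    \<open>f j\<close> and return them through \<open>f l\<close>. Their sum is zero, so the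
    numerator of \<open>F\<close> is unchanged.\<close>
  define d where "d p = (if p = i then - a else if p = j then - b else if p = l then a + b else 0)" for p
  define f' where "f' p t = f p t + d p" for p t
  have "sum d {1..n} = sum d {i, j, l}"
    by (rule sum.mono_neutral_right) (use ijl in \<open>auto simp: d_def\<close>)
  then have "sum d {1..n} = 0"
    using ijl by (simp add: d_def)
  then have "defined_by n I F f'"
    using f I(1) C2_real_add_const
    by (auto simp: defined_by_def f'_def[abs_def] sum.distrib)
  moreover have "\<forall>t\<in>I i. f' i t = c * t"
    using a by (simp add: f'_def d_def)
  moreover have "\<forall>t\<in>I j. f' j t = c * t"
    using b ijl(4) by (simp add: f'_def d_def)
  ultimately show ?thesis
    using that ijl by blast
qed

section \<open>Uniqueness of the coefficient and the equivalence\<close>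

text \<open>A nonempty open set of reals is not \<open>{0}\<close>, so it contains a nonzero point
  by which to cancel.\<close>

lemma linear_coeff_unique:
  fixes c d :: real
  assumes "open_interval S" "\<And>t. t \<in> S \<Longrightarrow> c * t = d * t"
  shows "c = d"
proof -
  have "S \<noteq> {0}" "S \<noteq> {}"
    using assms(1) not_open_singleton by (auto simp: open_interval_def)
  then obtain t where "t \<in> S" "t \<noteq> 0"
    by blast
  then show ?thesis
    using assms(2) by auto
qed

theorem theorem1:
  fixes n :: nat
    and I :: "nat \<Rightarrow> real set"
    and F :: "(nat \<Rightarrow> real) \<Rightarrow> real"
    and f :: "nat \<Rightarrow> real \<Rightarrow> real"
  assumes "n \<ge> 3"
    and "local_quasigroup n I F"
    and "defined_by n I F f"
  shows "irreducible_quasigroup n I F \<longleftrightarrow>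
    (\<forall>f'. defined_by n I F f' \<longrightarrow>
      (\<forall>i\<in>{1..n}. \<forall>j\<in>{1..n}. i \<noteq> j \<longrightarrow>
         \<not> (linear_homogeneous (I i) (f' i) \<and> linear_homogeneous (I j) (f' j)) \<or>
         (\<exists>c d. (\<forall>t\<in>I i. f' i t = c * t) \<and> (\<forall>t\<in>I j. f' j t = d * t) \<and> c \<noteq> d)))"
    (is "_ \<longleftrightarrow> ?R")
proof
  have I: "open_interval (I p)" if "p \<in> {1..n}" for p
    using assms(2) that by (auto simp: local_quasigroup_def)
  {
    assume "irreducible_quasigroup n I F"
    \<comment> \<open>No common coefficient is possible, so whenever both functions are linear
      homogeneous the coefficients witnessing it are distinct.\<close>
    then have "\<not> ((\<forall>t\<in>I i. f' i t = c * t) \<and> (\<forall>t\<in>I j. f' j t = c * t))"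
      if "defined_by n I F f'" "i \<in> {1..n}" "j \<in> {1..n}" "i \<noteq> j" for f' i j c
      using reducible_if_equal_linear[OF assms(1) I that] by (auto simp: irreducible_quasigroup_def)
    then show ?R
      unfolding linear_homogeneous_def by metis
  next
    assume R: ?R
    show "irreducible_quasigroup n I F"
      unfolding irreducible_quasigroup_def
    proof
      assume red: "reducible n I F"
      obtain f' i j c where *: "defined_by n I F f'" "i \<in> {1..n}" "j \<in> {1..n}" "i \<noteq> j"
        "\<forall>t\<in>I i. f' i t = c * t" "\<forall>t\<in>I j. f' j t = c * t"
        by (rule equal_linear_if_reducible[OF assms red])
      have "linear_homogeneous (I i) (f' i)" "linear_homogeneous (I j) (f' j)"
        using *(5,6) by (auto simp: linear_homogeneous_def)
      \<comment> \<open>The criterion yields distinct coefficients, whereas uniqueness identifies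
        both with the common \<open>c\<close> obtained from the reduction.\<close>
      then obtain d e where de: "\<And>t. t \<in> I i \<Longrightarrow> f' i t = d * t" "\<And>t. t \<in> I j \<Longrightarrow> f' j t = e * t"
        "d \<noteq> e"
        using R[rule_format, OF *(1-4)] by blast
      have "d = c"
        by (rule linear_coeff_unique[OF I[OF *(2)]]) (metis *(5) de(1))
      moreover have "e = c"
        by (rule linear_coeff_unique[OF I[OF *(3)]]) (metis *(6) de(2))
      ultimately show False
        using de(3) by simp
    qed
  }
qed

end
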